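(* Let $k\ge0$ and $n\in[2^k,2^{k+1}-1)=\{2^k,\dots,2^{k+1}-2\}$, with binary expansion $\beta(n)=b_1b_2\cdots b_{k+1}$. Let $j$ be the maximum index with $b_1=\dots=b_j=1$, and define $n'$ by $\beta(n')=1\,b_{j+2}b_{j+3}\cdots b_{k+1}$. Then $$M(n)=\begin{bmatrix} q^{-k+2j-1}h_q(n'-1) & q^{-k+1}h_q(n-2^k-1)\\ q^{-k+2j-2}h_q(n') & q^{-k}h_q(n-2^k)\end{bmatrix}.$$ If $n=2^{k+1}-1$, the same formula holds with the first column replaced by $\begin{bmatrix} q^k\\ 0\end{bmatrix}$.
   Context: $h_q(n)=\sum_{\eta}q^{\ell(\eta)}$, summed over hyperbinary partitions $\eta$ of $n$ (partitions of $n$ into powers of $2$ with each part used at most twice), $\ell(\eta)$ the number of parts; $h_q(-1)=0$, $h_q(0)=1$. Binary expansions $\beta(n)=b_1\cdots b_{k+1}$ are written with $b_1=1$ the most significant digit. Let $L=\begin{bmatrix}1&0\\1&q^{-1}\end{bmatrix}$ and $R=\begin{bmatrix}q&1\\0&1\end{bmatrix}$. For $n\ge1$ with $\beta(n)=b_1b_2\cdots b_{k+1}$, $M(n)$ is the matrix product obtained from the word $b_{k+1}b_k\cdots b_2$ (drop the leading $1$ and reverse) by replacing each $0$ by $L$ and each $1$ by $R$ (the empty product being the identity). *)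

theory Defs
  imports "HOL-Analysis.Cartesian_Space" "HOL-Library.Multiset"
begin

text \<open>
  The argument is an integer so that \<open>n = -1\<close> is allowed; there is no hyperbinary partition
  of a negative integer. The indeterminate \<open>q\<close> is rendered as an arbitrary nonzero element of an
  arbitrary field; the fraction field of the integer polynomials gives the formal identity.
\<close>

definition hyperbinary_partitions :: "int \<Rightarrow> nat multiset set" where
  "hyperbinary_partitions n =
     {\<eta>. (\<forall>p\<in>#\<eta>. \<exists>i. p = 2 ^ i) \<and> (\<forall>p. count \<eta> p \<le> 2) \<and> int (sum_mset \<eta>) = n}"

definition hq :: "'a::comm_semiring_1 \<Rightarrow> int \<Rightarrow> 'a" where
  "hq q n = (\<Sum>\<eta>\<in>hyperbinary_partitions n. q ^ size \<eta>)"

lemma finite_hyperbinary_partitions: "finite (hyperbinary_partitions n)"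
proof -
  have "hyperbinary_partitions n \<subseteq> mset ` {xs. set xs \<subseteq> {..nat n} \<and> length xs \<le> nat n}"
  proof
    fix \<eta> assume \<eta>: "\<eta> \<in> hyperbinary_partitions n"
    obtain xs where xs: "\<eta> = mset xs" by (metis ex_mset)
    have pos: "\<And>p. p \<in> set xs \<Longrightarrow> 1 \<le> p" and sum: "sum_list xs = nat n"
      using \<eta> unfolding hyperbinary_partitions_def xs
      by (auto simp: sum_mset_sum_list simp del: of_nat_sum_mset)
    have "length xs \<le> sum_list xs"
      using pos by (induction xs) fastforce+
    moreover have "set xs \<subseteq> {..nat n}"
    proof
      fix x assume "x \<in> set xs"
      then have "x \<le> sum_list xs" by (rule member_le_sum_list) simp
      with sum show "x \<in> {..nat n}" by simp
    qed
    ultimately show "\<eta> \<in> mset ` {xs. set xs \<subseteq> {..nat n} \<and> length xs \<le> nat n}"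
      using xs sum by auto
  qed
  then show ?thesis
    by (rule finite_subset) (intro finite_imageI finite_lists_length_le finite_atMost)
qed

lemma hq_minus_one: "hq q (-1) = 0"
  by (simp add: hq_def hyperbinary_partitions_def del: of_nat_sum_mset)

lemma hq_zero: "hq q 0 = 1"
proof -
  have "hyperbinary_partitions 0 = {{#}}"
  proof -
    have "\<eta> = {#}" if "\<forall>p\<in>#\<eta>. \<exists>i. p = 2 ^ i" "sum_mset \<eta> = 0" for \<eta> :: "nat multiset"
    proof (rule ccontr)
      assume "\<eta> \<noteq> {#}"
      then obtain p where "p \<in># \<eta>" by blast
      moreover from this have "p = 0" using that(2) by simp
      ultimately have "\<exists>i. (0::nat) = 2 ^ i" using that(1) by blast
      then show False by simp
    qed
    then show ?thesis
      unfolding hyperbinary_partitions_def by (auto simp del: of_nat_sum_mset sum_mset_0_iff)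
  qed
  then show ?thesis by (simp add: hq_def)
qed

text \<open>
  Binary expansion, most significant digit first; \<open>b\<^sub>i\<close> is the list element of index \<open>i - 1\<close>.
\<close>

fun binary_expansion :: "nat \<Rightarrow> nat list" where
  "binary_expansion n = (if n = 0 then [] else binary_expansion (n div 2) @ [n mod 2])"

declare binary_expansion.simps [simp del]

definition digit :: "nat \<Rightarrow> nat \<Rightarrow> nat" where
  "digit n i = binary_expansion n ! (i - 1)"

lemma binary_expansion_0: "binary_expansion 0 = []"
  by (subst binary_expansion.simps) simp

lemma binary_expansion_pos:
  "n > 0 \<Longrightarrow> binary_expansion n = binary_expansion (n div 2) @ [n mod 2]"
  by (subst binary_expansion.simps) simp

text \<open>Numbers may thus be specified by prescribing their binary expansion.\<close>

lemma binary_expansion_ex1: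
  assumes "set bs \<subseteq> {0, 1}"
  shows "\<exists>!n. binary_expansion n = 1 # bs"
proof -
  have nz: "n \<noteq> 0" if "binary_expansion n = 1 # xs" for n xs
    using that by (cases "n = 0") (auto simp: binary_expansion_0)
  show ?thesis using assms
  proof (induction bs rule: rev_induct)
    case Nil
    have e1: "binary_expansion 1 = [1]"
      by (simp add: binary_expansion_pos binary_expansion_0)
    have "n = 1" if n: "binary_expansion n = [1]" for n
    proof -
      have "binary_expansion (n div 2) @ [n mod 2] = [1]"
        using n nz[OF n] binary_expansion_pos[of n] by simp
      then have *: "binary_expansion (n div 2) = []" and "n mod 2 = 1"
        by simp_all
      have "n div 2 = 0"
        using * binary_expansion_pos[of "n div 2"] by (cases "n div 2 = 0") simp_all
      with \<open>n mod 2 = 1\<close> show ?thesis by presburger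
    qed
    with e1 show ?case by blast
  next
    case (snoc b bs)
    then obtain m where m: "binary_expansion m = 1 # bs"
      and uniq: "\<And>m'. binary_expansion m' = 1 # bs \<Longrightarrow> m' = m" by auto
    have b: "b < 2" using snoc.prems by auto
    have "m \<noteq> 0" using nz[OF m] .
    then have "binary_expansion (2 * m + b) = 1 # bs @ [b]"
      using b m binary_expansion_pos[of "2 * m + b"] by simp
    moreover have "n = 2 * m + b" if n: "binary_expansion n = 1 # bs @ [b]" for n
    proof -
      have "binary_expansion (n div 2) @ [n mod 2] = (1 # bs) @ [b]"
        using n nz[OF n] binary_expansion_pos[of n] by simp
      then have "binary_expansion (n div 2) = 1 # bs" "n mod 2 = b"
        by (simp_all only: append1_eq_conv)
      with uniq show ?thesis by (metis mult_div_mod_eq)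
    qed
    ultimately show ?case by blast
  qed
qed

definition mat2 :: "'a::zero \<Rightarrow> 'a \<Rightarrow> 'a \<Rightarrow> 'a \<Rightarrow> 'a ^ 2 ^ 2" where
  "mat2 a b c d = vector [vector [a, b], vector [c, d]]"

definition Lq :: "'a::field \<Rightarrow> 'a ^ 2 ^ 2" where
  "Lq q = mat2 1 0
               1 (inverse q)"

definition Rq :: "'a::field \<Rightarrow> 'a ^ 2 ^ 2" where
  "Rq q = mat2 q 1
               0 1"

definition Mq :: "'a::field \<Rightarrow> nat \<Rightarrow> 'a ^ 2 ^ 2" where
  "Mq q n = foldr (**) (map (\<lambda>b. if b = 0 then Lq q else Rq q) (rev (tl (binary_expansion n)))) (mat 1)"

end

theory Submission
  imports Defs
begin

text \<open>
  Splitting off the parts equal to \<open>1\<close> gives \<open>h(2n + 1) = q h(n)\<close> and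
  \<open>h(2n) = h(n) + q\<^sup>2 h(n - 1)\<close>. Equivalently, up to the factor \<open>q\<^sup>-\<^sup>1\<close>, the matrices \<open>L\<close> and \<open>R\<close> map the
  column \<open>(q h(a - 1), h(a))\<close> to the corresponding column for \<open>2a\<close> and \<open>2a + 1\<close>. The second column of
  \<open>M(n)\<close> is obtained by starting from \<open>(0, 1)\<close>, which is the column for \<open>a = 0\<close>. For the first
  column, \<open>R\<close> fixes the direction \<open>(1, 0)\<close>, scaling it by \<open>q\<close>, and the first \<open>L\<close> turns it
  into \<open>(1, 1)\<close>, which is proportional to the column for \<open>a = 1\<close>.
\<close>

section \<open>Removing the parts equal to 1 from a hyperbinary partition\<close>

lemma count_double_image_mset:
  "count (image_mset ((*) 2) M) (2 * p) = count M (p::nat)"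
  by (induction M) auto

lemma count_double_image_mset_odd:
  "odd p \<Longrightarrow> count (image_mset ((*) 2) M) (p::nat) = 0"
  by (auto simp: count_eq_zero_iff)

lemma sum_mset_double: "sum_mset (image_mset ((*) 2) M) = 2 * sum_mset (M :: nat multiset)"
  by (induction M) auto

text \<open>Since 1 is the only odd power of 2, removing the \<open>c\<close> copies of 1 leaves
  even parts, and halving these gives a hyperbinary partition of \<open>m\<close>. Conversely,
  doubling preserves multiplicities and creates no part 1, so up to two ones can be added.\<close>

lemma hyperbinary_partitions_iff:
  "\<eta> \<in> hyperbinary_partitions N \<longleftrightarrow>
     (\<exists>c\<le>2. \<exists>m. N = 2 * m + int c \<and>
        (\<exists>\<zeta>\<in>hyperbinary_partitions m. \<eta> = replicate_mset c 1 + image_mset ((*) 2) \<zeta>))"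
  (is "?L \<longleftrightarrow> ?R")
proof
  assume L: ?L
  define c where "c = count \<eta> 1"
  define \<zeta> where "\<zeta> = image_mset (\<lambda>p. p div 2) (filter_mset (\<lambda>p. p \<noteq> 1) \<eta>)"
  have pow: "\<exists>i. p = 2 ^ i" if "p \<in># \<eta>" for p
    using L that by (auto simp: hyperbinary_partitions_def)
  have even: "even p" if "p \<in># \<eta>" "p \<noteq> 1" for p
    using pow[OF that(1)] that(2) by (metis even_power even_numeral power_0 neq0_conv)
  have "image_mset ((*) 2) \<zeta> = image_mset (\<lambda>p. p) (filter_mset (\<lambda>p. p \<noteq> 1) \<eta>)"
    \<comment> \<open>Halving loses nothing here: every part other than 1 is even, so doubling
      undoes it.\<close>
    unfolding \<zeta>_def multiset.map_comp by (rule image_mset_cong) (auto simp: even)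
  then have D: "image_mset ((*) 2) \<zeta> = filter_mset (\<lambda>p. p \<noteq> 1) \<eta>" by simp
  have \<eta>: "\<eta> = replicate_mset c 1 + image_mset ((*) 2) \<zeta>"
    unfolding D c_def by (rule multiset_eqI) auto
  have "\<exists>i. p = 2 ^ i" if "p \<in># \<zeta>" for p
  proof -
    from that obtain r where r: "r \<in># \<eta>" "r \<noteq> 1" "p = r div 2" by (auto simp: \<zeta>_def)
    then obtain i where i: "r = 2 ^ i" using pow by blast
    with r have "i \<noteq> 0" by (metis power_0)
    then have "p = 2 ^ (i - 1)" using i r(3) by (cases i) auto
    then show ?thesis ..
  qed
  moreover have "count \<zeta> p \<le> 2" for p
  proof -
    have "count \<zeta> p = count (filter_mset (\<lambda>p. p \<noteq> 1) \<eta>) (2 * p)"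
      by (simp only: D[symmetric] count_double_image_mset)
    also have "\<dots> \<le> 2" using L by (auto simp: hyperbinary_partitions_def)
    finally show ?thesis .
  qed
  ultimately have "\<zeta> \<in> hyperbinary_partitions (int (sum_mset \<zeta>))"
    by (simp add: hyperbinary_partitions_def)
  moreover have "N = 2 * int (sum_mset \<zeta>) + int c"
  proof -
    have "N = int (sum_mset \<eta>)" using L by (simp add: hyperbinary_partitions_def)
    also have "sum_mset \<eta> = c + 2 * sum_mset \<zeta>"
      by (subst \<eta>) (simp only: sum_mset.union sum_mset_double sum_mset_replicate_mset, simp)
    finally show ?thesis by simp
  qed
  moreover have "c \<le> 2" using L by (auto simp: c_def hyperbinary_partitions_def)
  ultimately show ?R using \<eta> by blast
next
  assume ?R
  then obtain c m \<zeta> where c: "c \<le> 2" and N: "N = 2 * m + int c"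
    and \<zeta>: "\<zeta> \<in> hyperbinary_partitions m"
    and \<eta>: "\<eta> = replicate_mset c 1 + image_mset ((*) 2) \<zeta>" by blast
  have "\<exists>i. p = 2 ^ i" if "p \<in># \<eta>" for p
  proof (cases "p = 1")
    case True
    then have "p = 2 ^ 0" by simp
    then show ?thesis ..
  next
    case False
    with that obtain r where "r \<in># \<zeta>" "p = 2 * r" by (auto simp: \<eta> split: if_splits)
    moreover from this \<zeta> obtain i where "r = 2 ^ i"
      unfolding hyperbinary_partitions_def by blast
    ultimately have "p = 2 ^ Suc i" by simp
    then show ?thesis ..
  qed
  moreover have "count \<eta> p \<le> 2" for p
  proof (cases "even p")
    case True
    then obtain r where "p = 2 * r" by blast
    moreover have "count \<zeta> r \<le> 2" using \<zeta> by (simp add: hyperbinary_partitions_def)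
    ultimately show ?thesis by (simp add: \<eta> count_double_image_mset)
  next
    case False
    then show ?thesis using c by (simp add: \<eta> count_double_image_mset_odd)
  qed
  moreover have "int (sum_mset \<eta>) = N"
  proof -
    have "sum_mset \<eta> = c + 2 * sum_mset \<zeta>"
      by (subst \<eta>) (simp only: sum_mset.union sum_mset_double sum_mset_replicate_mset, simp)
    moreover have "int (sum_mset \<zeta>) = m" using \<zeta> by (simp add: hyperbinary_partitions_def)
    ultimately show ?thesis by (simp add: N del: of_nat_sum_mset)
  qed
  ultimately show ?L by (simp add: hyperbinary_partitions_def)
qed

text \<open>The map is injective because the multiplicity of \<open>p\<close> in \<zeta> is that of
  \<open>2 * p\<close> in the image, where the added ones do not count. It adds \<open>c\<close>
  parts, whence the factor \<open>q ^ c\<close>.\<close>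

lemma sum_image_double:
  fixes q :: "'a::comm_semiring_1"
  shows "(\<Sum>\<eta>\<in>(\<lambda>\<zeta>. replicate_mset c 1 + image_mset ((*) 2) \<zeta>) ` hyperbinary_partitions m.
      q ^ size \<eta>) = q ^ c * hq q m"
proof -
  have "inj_on (\<lambda>\<zeta>. replicate_mset c 1 + image_mset ((*) (2::nat)) \<zeta>) (hyperbinary_partitions m)"
    by (rule inj_onI) (metis add_left_imp_eq count_double_image_mset multiset_eqI)
  then show ?thesis
    by (simp add: sum.reindex hq_def power_add sum_distrib_left)
qed

text \<open>Parity forces exactly one part equal to 1. No sign condition on \<open>n\<close> is
  imposed, so that \<open>n = -1\<close> is covered as well.\<close>

lemma hq_odd: "hq q (2 * n + 1) = q * hq q n"
proof -
  have "hyperbinary_partitions (2 * n + 1) =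
      (\<lambda>\<zeta>. replicate_mset 1 1 + image_mset ((*) 2) \<zeta>) ` hyperbinary_partitions n"
  proof (rule set_eqI)
    fix \<eta>
    have *: "c = 1 \<and> m = n" if "c \<le> 2" "2 * n + 1 = 2 * m + int c" for c m
      using that by presburger
    show "\<eta> \<in> hyperbinary_partitions (2 * n + 1) \<longleftrightarrow>
        \<eta> \<in> (\<lambda>\<zeta>. replicate_mset 1 1 + image_mset ((*) 2) \<zeta>) ` hyperbinary_partitions n"
      (is "_ \<longleftrightarrow> \<eta> \<in> ?A")
    proof
      assume "\<eta> \<in> hyperbinary_partitions (2 * n + 1)"
      then obtain c m \<zeta> where "c \<le> 2" "2 * n + 1 = 2 * m + int c"
        "\<zeta> \<in> hyperbinary_partitions m" "\<eta> = replicate_mset c 1 + image_mset ((*) 2) \<zeta>"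
        unfolding hyperbinary_partitions_iff[of \<eta> "2 * n + 1"] by blast
      with *[of c m] show "\<eta> \<in> ?A" by blast
    next
      have "1 \<le> (2::nat)" "2 * n + 1 = 2 * n + int 1" by simp_all
      moreover assume "\<eta> \<in> ?A"
      ultimately show "\<eta> \<in> hyperbinary_partitions (2 * n + 1)"
        unfolding hyperbinary_partitions_iff[of \<eta> "2 * n + 1"] by blast
    qed
  qed
  then show ?thesis
    using sum_image_double[of q 1 n] by (simp add: hq_def)
qed

text \<open>Parity leaves zero or two parts equal to 1. These classes are disjoint and contribute
  the two summands.\<close>

lemma hq_even: "hq q (2 * n) = hq q n + q ^ 2 * hq q (n - 1)"
proof -
  let ?f = "\<lambda>c \<zeta>. replicate_mset c (1::nat) + image_mset ((*) 2) \<zeta>"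
  let ?A = "?f 0 ` hyperbinary_partitions n" and ?B = "?f 2 ` hyperbinary_partitions (n - 1)"
  have "hyperbinary_partitions (2 * n) = ?A \<union> ?B"
  proof (rule set_eqI)
    fix \<eta>
    have *: "c = 0 \<and> m = n \<or> c = 2 \<and> m = n - 1" if "c \<le> 2" "2 * n = 2 * m + int c" for c m
      using that by presburger
    show "\<eta> \<in> hyperbinary_partitions (2 * n) \<longleftrightarrow> \<eta> \<in> ?A \<union> ?B"
    proof
      assume "\<eta> \<in> hyperbinary_partitions (2 * n)"
      then obtain c m \<zeta> where "c \<le> 2" "2 * n = 2 * m + int c"
        "\<zeta> \<in> hyperbinary_partitions m" "\<eta> = ?f c \<zeta>"
        unfolding hyperbinary_partitions_iff[of \<eta> "2 * n"] by blast
      with *[of c m] show "\<eta> \<in> ?A \<union> ?B" by blast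
    next
      have "0 \<le> (2::nat)" "2 \<le> (2::nat)" "2 * n = 2 * n + int 0" "2 * n = 2 * (n - 1) + int 2"
        by simp_all
      moreover assume "\<eta> \<in> ?A \<union> ?B"
      ultimately show "\<eta> \<in> hyperbinary_partitions (2 * n)"
        unfolding hyperbinary_partitions_iff[of \<eta> "2 * n"] by blast
    qed
  qed
  moreover have "?A \<inter> ?B = {}"
  proof -
    have "count (?f 0 \<zeta>) 1 \<noteq> count (?f 2 \<zeta>') 1" for \<zeta> \<zeta>'
      by (simp add: count_double_image_mset_odd)
    then show ?thesis by (metis (no_types, lifting) disjoint_iff imageE)
  qed
  ultimately have "hq q (2 * n) = (\<Sum>\<eta>\<in>?A. q ^ size \<eta>) + (\<Sum>\<eta>\<in>?B. q ^ size \<eta>)"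
    by (simp only: hq_def)
      (intro sum.union_disjoint finite_imageI finite_hyperbinary_partitions)
  then show ?thesis by (simp only: sum_image_double) simp
qed

lemma hq_one: "hq q 1 = q"
  using hq_odd[of q 0] by (simp add: hq_zero)

section \<open>Binary expansions and their values\<close>

lemma set_binary_expansion: "set (binary_expansion n) \<subseteq> {0, 1}"
proof (induction n rule: less_induct)
  case (less n)
  then show ?case
    by (cases "n = 0") (auto simp: binary_expansion_0 binary_expansion_pos[of n])
qed

text \<open>Horner's scheme. The accumulator is an integer so that it can serve directly as an
  argument of \<open>hq\<close>.\<close>

lemma binary_expansion_value:
  "foldl (\<lambda>a b. 2 * a + int b) 0 (binary_expansion n) = int n"
proof (induction n rule: less_induct)
  case (less n)
  then show ?case
    by (cases "n = 0") (auto simp: binary_expansion_0 binary_expansion_pos[of n] zdiv_int zmod_int)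
qed

lemma length_binary_expansion:
  "2 ^ k \<le> n \<Longrightarrow> n < 2 ^ Suc k \<Longrightarrow> length (binary_expansion n) = Suc k"
proof (induction k arbitrary: n)
  case 0
  then have "n = 1" by simp
  then show ?case by (simp add: binary_expansion_pos binary_expansion_0)
next
  case (Suc k)
  then have "n > 0" by (meson less_le_trans zero_less_numeral zero_less_power)
  moreover have "length (binary_expansion (n div 2)) = Suc k"
    using Suc.prems by (intro Suc.IH) auto
  ultimately show ?case by (simp add: binary_expansion_pos[of n])
qed

lemma binary_expansion_Cons: "n > 0 \<Longrightarrow> \<exists>bs. binary_expansion n = 1 # bs"
proof (induction n rule: less_induct)
  case (less n)
  show ?case
  proof (cases "n = 1")
    case False
    with less.prems have "n div 2 < n" "n div 2 > 0" by auto
    from less.IH[OF this] show ?thesis using less.prems by (auto simp: binary_expansion_pos[of n])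
  qed (simp add: binary_expansion_pos binary_expansion_0)
qed

text \<open>Relates the starting values 1 and 0, that is, a digit word with and without a leading 1
  in front.\<close>

lemma foldl_binary_shift:
  "foldl (\<lambda>a b. 2 * a + int b) a bs = 2 ^ length bs * a + foldl (\<lambda>a b. 2 * a + int b) 0 bs"
  by (induction bs rule: rev_induct) (simp_all add: algebra_simps)

lemma foldl_binary_replicate_1:
  "foldl (\<lambda>a b. 2 * a + int b) 0 (replicate k 1) = 2 ^ k - 1"
proof -
  \<comment> \<open>The start value is generalised for the induction: reading a digit 1 doubles
    \<open>a + 1\<close>.\<close>
  have "foldl (\<lambda>a b. 2 * a + int b) a (replicate k 1) = 2 ^ k * (a + 1) - 1" for a
    by (induction k arbitrary: a) (simp_all add: algebra_simps)
  then show ?thesis by simp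
qed

lemma binary_expansion_all_ones: "binary_expansion (2 ^ k - 1) = replicate k 1"
proof (induction k)
  case 0
  then show ?case by (simp add: binary_expansion_0)
next
  case (Suc k)
  have odd: "binary_expansion (2 * m + 1) = binary_expansion m @ [1]" for m
    by (subst binary_expansion_pos) simp_all
  have "(2::nat) ^ Suc k - 1 = 2 * (2 ^ k - 1) + 1"
    using one_le_power[of "2::nat" k] by (simp only: power_Suc) linarith
  then have "binary_expansion (2 ^ Suc k - 1) = replicate k 1 @ [1]"
    by (simp only: odd Suc.IH)
  then show ?case by (simp add: replicate_append_same)
qed

text \<open>Digits are indexed from 1, so \<open>b\<close> is the digit of index
  \<open>j + 1\<close>, and it ends the leading run of ones.\<close>

lemma Max_leading_ones:
  assumes "b \<noteq> 1"
    and "binary_expansion n = replicate j 1 @ b # cs" "j \<ge> 1" "length (binary_expansion n) = k + 1"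
  shows "Max {i \<in> {1..k + 1}. \<forall>m\<in>{1..i}. digit n m = 1} = j"
proof (rule Max_eqI)
  have dj: "digit n (Suc j) = b" and d1: "m \<in> {1..j} \<Longrightarrow> digit n m = 1" for m
    using assms(2) by (auto simp: digit_def nth_append)
  show "j \<in> {i \<in> {1..k + 1}. \<forall>m\<in>{1..i}. digit n m = 1}"
    using d1 assms by auto
  fix i assume "i \<in> {i \<in> {1..k + 1}. \<forall>m\<in>{1..i}. digit n m = 1}"
  then show "i \<le> j" using dj assms(1) by (force simp: not_le[symmetric])
qed simp

section \<open>Matrix products indexed by digit words\<close>

lemma mat2_mult_vector:
  "mat2 a b c d *v vector [x, y] = (vector [a * x + b * y, c * x + d * y] :: 'a::semiring_1 ^ 2)"
  by (simp add: mat2_def matrix_vector_mult_def vec_eq_iff forall_2 sum_2)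

lemma smult_vector2: "s *s vector [x, y] = (vector [s * x, s * y] :: 'a::semiring_1 ^ 2)"
  by (simp add: vector_scalar_mult_def vec_eq_iff forall_2)

text \<open>The columns of a matrix are the images of the standard basis vectors. This allows the
  two columns of \<open>Mq q n\<close> to be computed independently.\<close>

lemma mat2_eqI:
  fixes A :: "'a::semiring_1 ^ 2 ^ 2"
  assumes "A *v vector [1, 0] = vector [a, c]" "A *v vector [0, 1] = vector [b, d]"
  shows "A = mat2 a b c d"
  using assms
  by (simp add: mat2_def matrix_vector_mult_def vec_eq_iff forall_2 sum_2)

text \<open>The product in \<open>Mq\<close> for an arbitrary word without the leading digit, so
  that a word can be cut at its first 0.\<close>

definition word_matrix :: "'a::field \<Rightarrow> nat list \<Rightarrow> 'a ^ 2 ^ 2" where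
  "word_matrix q bs = foldr (**) (map (\<lambda>b. if b = 0 then Lq q else Rq q) (rev bs)) (mat 1)"

lemma word_matrix_Nil: "word_matrix q [] = mat 1"
  by (simp add: word_matrix_def)

lemma word_matrix_snoc:
  "word_matrix q (bs @ [b]) = (if b = 0 then Lq q else Rq q) ** word_matrix q bs"
  by (simp add: word_matrix_def)

text \<open>The order of the factors is reversed: digits read later act later, hence from the
  left.\<close>

lemma word_matrix_append: "word_matrix q (bs @ cs) = word_matrix q cs ** word_matrix q bs"
  by (induction cs rule: rev_induct)
    (simp_all add: word_matrix_Nil word_matrix_snoc matrix_mul_assoc flip: append_assoc)

lemma Mq_eq_word_matrix: "binary_expansion n = b # bs \<Longrightarrow> Mq q n = word_matrix q bs"
  by (simp add: Mq_def word_matrix_def)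

text \<open>Reading a digit \<open>b\<close> takes the column for \<open>a\<close> to
  \<open>1 / q\<close> times the column for \<open>2 * a + b\<close>, by the two recursions for
  \<open>hq\<close>. The power of \<open>q\<close> thus counts the digits, while the fold tracks the
  argument.\<close>

lemma word_matrix_mult_hq:
  fixes q :: "'a::field"
  assumes "q \<noteq> 0" "set bs \<subseteq> {0, 1}"
  shows "word_matrix q bs *v vector [q * hq q (a - 1), hq q a] =
    (let N = foldl (\<lambda>a b. 2 * a + int b) a bs
     in vector [q powi (- int (length bs)) * (q * hq q (N - 1)),
                q powi (- int (length bs)) * hq q N])"
  using assms(2)
proof (induction bs rule: rev_induct)
  case Nil
  then show ?case by (simp add: word_matrix_Nil)
next
  case (snoc b bs)
  define m where "m = foldl (\<lambda>a b. 2 * a + int b) a bs"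
  define s where "s = q powi (- int (length bs))"
  have s: "q powi (- int (length (bs @ [b]))) = s / q"
  proof -
    have "- int (length (bs @ [b])) = - int (length bs) - 1" by simp
    moreover have "q powi (x - 1) = q powi x / q" for x
      using assms(1) by (simp add: power_int_diff)
    ultimately show ?thesis by (simp only: s_def)
  qed
  have IH: "word_matrix q bs *v vector [q * hq q (a - 1), hq q a]
      = vector [s * (q * hq q (m - 1)), s * hq q m]"
    using snoc by (simp add: m_def s_def Let_def)
  \<comment> \<open>The first entry of the column for \<open>2 * m\<close> has the odd argument
    \<open>2 * (m - 1) + 1\<close>.\<close>
  have odd: "hq q (2 * m - 1) = q * hq q (m - 1)"
    using hq_odd[of q "m - 1"] by (simp add: algebra_simps)
  have N: "foldl (\<lambda>a b. 2 * a + int b) a (bs @ [b]) = 2 * m + int b"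
    by (simp add: m_def)
  consider "b = 0" | "b = 1" using snoc.prems by auto
  then show ?case
  proof cases
    case 1
    then show ?thesis
      unfolding Let_def s N using assms(1) odd
      by (simp add: word_matrix_snoc matrix_vector_mul_assoc[symmetric] IH Lq_def mat2_mult_vector
          hq_even) (simp add: field_simps power2_eq_square)
  next
    case 2
    then show ?thesis
      unfolding Let_def s N using assms(1)
      by (simp add: word_matrix_snoc matrix_vector_mul_assoc[symmetric] IH Rq_def mat2_mult_vector
          hq_even hq_odd) (simp add: field_simps power2_eq_square)
  qed
qed

section \<open>The columns of M(n)\<close>

lemma word_matrix_ones:
  "word_matrix q (replicate i 1) *v vector [1, 0] = vector [q ^ i, 0]"
proof (induction i)
  case (Suc i)
  have "replicate (Suc i) (1::nat) = replicate i 1 @ [1]" by (simp add: replicate_append_same)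
  then show ?case
    using Suc by (simp only: word_matrix_snoc matrix_vector_mul_assoc[symmetric])
      (simp add: Rq_def mat2_mult_vector)
qed (simp add: word_matrix_Nil)

text \<open>The vector \<open>(0, 1)\<close> is the column for \<open>a = 0\<close>, because
  \<open>hq q (-1) = 0\<close> and \<open>hq q 0 = 1\<close>. Folding the digits after the leading 1
  from 0 instead of 1 yields \<open>n - 2 ^ k\<close>. The bounds cover both cases of the
  theorem.\<close>

lemma Mq_second_column:
  fixes q :: "'a::field"
  assumes "q \<noteq> 0" "2 ^ k \<le> n" "n < 2 ^ (k + 1)"
  shows "Mq q n *v vector [0, 1] = vector [q powi (- int k + 1) * hq q (int n - 2 ^ k - 1),
           q powi (- int k) * hq q (int n - 2 ^ k)]"
proof -
  have "n > 0" using assms(2) by (meson less_le_trans zero_less_numeral zero_less_power)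
  then obtain bs where bs: "binary_expansion n = 1 # bs" using binary_expansion_Cons by blast
  have len: "length bs = k" using length_binary_expansion[of k n] assms bs by simp
  have "foldl (\<lambda>a b. 2 * a + int b) 1 bs = int n"
    using binary_expansion_value[of n] bs by simp
  then have val: "foldl (\<lambda>a b. 2 * a + int b) 0 bs = int n - 2 ^ k"
    using foldl_binary_shift[of 1 bs] len by simp
  have "set bs \<subseteq> {0, 1}" using set_binary_expansion[of n] bs by auto
  from word_matrix_mult_hq[OF assms(1) this, of 0]
  have "Mq q n *v vector [0, 1] = vector [q powi (- int k) * (q * hq q (int n - 2 ^ k - 1)),
      q powi (- int k) * hq q (int n - 2 ^ k)]"
    by (simp add: val len hq_zero hq_minus_one Mq_eq_word_matrix[OF bs] Let_def)
  also have "q powi (- int k) * (q * hq q (int n - 2 ^ k - 1)) =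
      q powi (- int k + 1) * hq q (int n - 2 ^ k - 1)"
    using assms(1) power_int_add[of q "- int k" 1] by simp
  finally show ?thesis .
qed

theorem theorem4p2:
  fixes q :: "'a::field" and k n :: nat
  assumes "q \<noteq> 0"
  shows "(n \<in> {2 ^ k ..< 2 ^ (k + 1) - 1} \<longrightarrow>
           (\<forall>j n' :: nat.
              j = Max {i \<in> {1..k + 1}. \<forall>m\<in>{1..i}. digit n m = 1} \<longrightarrow>
              binary_expansion n' = 1 # drop (j + 1) (binary_expansion n) \<longrightarrow>
              Mq q n = mat2
                (q powi (- int k + 2 * int j - 1) * hq q (int n' - 1))
                (q powi (- int k + 1) * hq q (int n - 2 ^ k - 1))
                (q powi (- int k + 2 * int j - 2) * hq q (int n'))
                (q powi (- int k) * hq q (int n - 2 ^ k))))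
       \<and> (n = 2 ^ (k + 1) - 1 \<longrightarrow>
              Mq q n = mat2
                (q ^ k)
                (q powi (- int k + 1) * hq q (int n - 2 ^ k - 1))
                0
                (q powi (- int k) * hq q (int n - 2 ^ k)))"
proof (intro conjI impI allI)
  fix j n' :: nat
  assume n: "n \<in> {2 ^ k ..< 2 ^ (k + 1) - 1}"
    and j: "j = Max {i \<in> {1..k + 1}. \<forall>m\<in>{1..i}. digit n m = 1}"
    and n': "binary_expansion n' = 1 # drop (j + 1) (binary_expansion n)"
  have bounds: "2 ^ k \<le> n" "n < 2 ^ (k + 1)" using n by auto
  have "n > 0" using bounds(1) by (meson less_le_trans zero_less_numeral zero_less_power)
  then obtain bs where bs: "binary_expansion n = 1 # bs" using binary_expansion_Cons by blast
  have len: "length bs = k" using length_binary_expansion[of k n] bounds bs by simp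
  \<comment> \<open>Only the excluded value \<open>2 ^ (k + 1) - 1\<close> has all its digits equal
    to 1, so some digit of \<open>n\<close> is 0.\<close>
  have "bs \<noteq> replicate k 1"
  proof
    assume "bs = replicate k 1"
    then have "int n = 2 ^ Suc k - 1"
      using binary_expansion_value[of n] bs foldl_binary_replicate_1[of "Suc k"] by simp
    then have "int n = int (2 ^ (k + 1) - 1)" by (simp add: of_nat_diff)
    then have "n = 2 ^ (k + 1) - 1" by (simp only: of_nat_eq_iff)
    with n show False by simp
  qed
  \<comment> \<open>The ones counted here come after the leading digit, so the run has length
    \<open>j = i + 1\<close>.\<close>
  define i where "i = length (takeWhile (\<lambda>b. b = 1) bs)"
  have tw: "takeWhile (\<lambda>b. b = 1) bs = replicate i 1"
    unfolding i_def by (rule replicate_eqI) (auto dest: set_takeWhileD)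
  have "dropWhile (\<lambda>b. b = 1) bs \<noteq> []"
  proof
    assume "dropWhile (\<lambda>b. b = 1) bs = []"
    then have "bs = replicate i 1"
      using takeWhile_dropWhile_id[of "\<lambda>b. b = 1" bs] tw by (metis append_Nil2)
    with \<open>bs \<noteq> replicate k 1\<close> len show False by (metis length_replicate)
  qed
  then obtain b cs where dw: "dropWhile (\<lambda>b. b = 1) bs = b # cs" by (meson neq_Nil_conv)
  then have bs_eq: "bs = replicate i 1 @ b # cs"
    using takeWhile_dropWhile_id[of "\<lambda>b. b = 1" bs] tw by simp
  have digits: "set bs \<subseteq> {0, 1}" using set_binary_expansion[of n] bs by auto
  have "b \<noteq> 1" using dw by (metis (full_types) dropWhile_eq_Cons_conv)
  with digits bs_eq have b: "b = 0" by auto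
  have cs: "set cs \<subseteq> {0, 1}" using digits bs_eq by auto
  have "j = Suc i"
    unfolding j by (rule Max_leading_ones[of 0 _ _ cs]) (use bs bs_eq b len in auto)
  \<comment> \<open>Dropping \<open>j + 1\<close> digits removes the ones and the 0 that ends them.
    The new leading 1 of \<open>n'\<close> becomes the start value 1 of the next fold.\<close>
  then have "drop (j + 1) (binary_expansion n) = cs" by (simp add: bs bs_eq)
  then have val: "foldl (\<lambda>a b. 2 * a + int b) 1 cs = int n'"
    using binary_expansion_value[of n'] n' by simp
  have k: "int k = int i + 1 + int (length cs)" using len bs_eq by simp
  \<comment> \<open>The word is cut after its first 0: the ones act first, then \<open>Lq q\<close>,
    then the remaining digits \<open>cs\<close>.\<close>
  have "Mq q n = word_matrix q cs ** (Lq q ** word_matrix q (replicate i 1))"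
    using word_matrix_append[of q "replicate i 1 @ [0]" cs]
    by (simp add: Mq_eq_word_matrix[OF bs] bs_eq b word_matrix_snoc)
  then have "Mq q n *v vector [1, 0] = word_matrix q cs *v vector [q ^ i, q ^ i]"
    by (simp add: matrix_vector_mul_assoc[symmetric] word_matrix_ones[simplified] Lq_def mat2_mult_vector)
  \<comment> \<open>The column for \<open>a = 1\<close> is \<open>(q, q)\<close>, since
    \<open>hq q 0 = 1\<close> and \<open>hq q 1 = q\<close>. The scalar \<open>q ^ i / q\<close>
    corrects for this factor.\<close>
  also have "(vector [q ^ i, q ^ i] :: 'a ^ 2) = (q ^ i / q) *s vector [q * hq q (1 - 1), hq q 1]"
    using assms by (simp add: smult_vector2 hq_zero hq_one)
  also have "word_matrix q cs *v \<dots> =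
      (q ^ i / q) *s (word_matrix q cs *v vector [q * hq q (1 - 1), hq q 1])"
    by (rule vector_scalar_commute)
  also have "\<dots> = vector [(q ^ i / q * q powi (- int (length cs)) * q) * hq q (int n' - 1),
      (q ^ i / q * q powi (- int (length cs))) * hq q (int n')]"
    by (simp only: word_matrix_mult_hq[OF assms cs] val Let_def smult_vector2 mult.assoc)
  also have "q ^ i / q * q powi (- int (length cs)) = q powi (- int k + 2 * int j - 2)"
  proof -
    \<comment> \<open>Substituting \<open>k = i + 1 + length cs\<close> and \<open>j = i + 1\<close>
      leaves exponent \<open>i\<close> from the ones, -1 from the scaling and -1 for each digit in
      \<open>cs\<close>.\<close>
    have "- int k + 2 * int j - 2 = int i - 1 + (- int (length cs))"
      using k \<open>j = Suc i\<close> by simp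
    moreover have "q powi (int i - 1 + x) = q ^ i / q * q powi x" for x
      using assms by (simp add: power_int_add power_int_diff)
    ultimately show ?thesis by (simp only:)
  qed
  also have "\<dots> * q = q powi (- int k + 2 * int j - 1)"
    using assms power_int_add[of q "- int k + 2 * int j - 2" 1] by simp
  finally show "Mq q n = mat2
                (q powi (- int k + 2 * int j - 1) * hq q (int n' - 1))
                (q powi (- int k + 1) * hq q (int n - 2 ^ k - 1))
                (q powi (- int k + 2 * int j - 2) * hq q (int n'))
                (q powi (- int k) * hq q (int n - 2 ^ k))"
    using Mq_second_column[OF assms bounds] by (rule mat2_eqI)
next
  assume n: "n = 2 ^ (k + 1) - 1"
  have bounds: "2 ^ k \<le> n" "n < 2 ^ (k + 1)" by (simp_all add: n)
  \<comment> \<open>Here no digit 0 occurs, so \<open>(1, 0)\<close> is only scaled, once for each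
    of the \<open>k\<close> digits after the leading one.\<close>
  have "binary_expansion n = 1 # replicate k 1"
    using binary_expansion_all_ones[of "k + 1"] by (simp add: n)
  then have ones: "Mq q n = word_matrix q (replicate k 1)" by (rule Mq_eq_word_matrix)
  have "Mq q n *v vector [1, 0] = vector [q ^ k, 0]"
    unfolding ones by (rule word_matrix_ones)
  then show "Mq q n = mat2
                (q ^ k)
                (q powi (- int k + 1) * hq q (int n - 2 ^ k - 1))
                0
                (q powi (- int k) * hq q (int n - 2 ^ k))"
    using Mq_second_column[OF assms bounds] by (rule mat2_eqI)
qed

end
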